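(* Let $f\colon P\to Q$ and $f'\colon P'\to Q'$ be strongly connected quandle homomorphisms. Then the product $f\times f'\colon P\times P'\to Q\times Q'$ is strongly connected.
   Context: A quandle is a set $Q$ with bijections $s_x\colon Q\to Q$ ($x\in Q$) such that $s_x(x)=x$ and $s_x\circ s_y=s_{s_x(y)}\circ s_x$ for all $x,y\in Q$. A quandle homomorphism $f\colon P\to Q$ is a map with $f(s_x(y))=s_{f(x)}(f(y))$ for all $x,y\in P$. For a surjective quandle homomorphism $f\colon P\to Q$, the relative transvection group is $\mathrm{Trans}_{\mathrm{rel}}(f)=\langle s_xs_y^{-1}\mid x,y\in P,\ f(x)=f(y)\rangle$, a group of permutations of $P$ preserving each fiber of $f$. The homomorphism $f$ is strongly connected if it is surjective and $\mathrm{Trans}_{\mathrm{rel}}(f)$ acts transitively on every fiber of $f$. Products of quandles carry the componentwise structure $s_{(x,x')}=s_x\times s_{x'}$. *)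

theory Defs
  imports "HOL-Algebra.Group_Action" "HOL-Algebra.Elementary_Groups"
begin

text \<open>\<open>qsym Q x y\<close> is the value \<open>s\<^sub>x(y)\<close>. As usual in HOL-Algebra, only arguments in the carrier
  matter; no assumption is made on the values of \<open>qsym\<close> elsewhere.\<close>

record 'a quandle_struct = "'a partial_object" +
  qsym :: "'a \<Rightarrow> 'a \<Rightarrow> 'a"

locale quandle =
  fixes Q :: "('a, 'm) quandle_struct_scheme"
  assumes qsym_bij: "x \<in> carrier Q \<Longrightarrow> bij_betw (qsym Q x) (carrier Q) (carrier Q)"
    and qsym_fixes: "x \<in> carrier Q \<Longrightarrow> qsym Q x x = x"
    and qsym_distrib:
      "\<lbrakk>x \<in> carrier Q; y \<in> carrier Q; z \<in> carrier Q\<rbrakk>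
        \<Longrightarrow> qsym Q x (qsym Q y z) = qsym Q (qsym Q x y) (qsym Q x z)"

locale quandle_hom = P: quandle P + Q: quandle Q
  for P :: "('a, 'm) quandle_struct_scheme" and Q :: "('b, 'n) quandle_struct_scheme" +
  fixes f :: "'a \<Rightarrow> 'b"
  assumes hom_closed: "f \<in> carrier P \<rightarrow> carrier Q"
    and hom_qsym:
      "\<lbrakk>x \<in> carrier P; y \<in> carrier P\<rbrakk> \<Longrightarrow> f (qsym P x y) = qsym Q (f x) (f y)"

text \<open>The restriction makes \<open>s\<^sub>x\<close> extensional, as elements of \<^const>\<open>BijGroup\<close> have to be.\<close>

definition point_symmetry :: "('a, 'm) quandle_struct_scheme \<Rightarrow> 'a \<Rightarrow> 'a \<Rightarrow> 'a"
  where "point_symmetry P x = restrict (qsym P x) (carrier P)"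

definition trans_rel :: "('a, 'm) quandle_struct_scheme \<Rightarrow> ('a \<Rightarrow> 'b) \<Rightarrow> ('a \<Rightarrow> 'a) monoid"
  where "trans_rel P f =
    subgroup_generated (BijGroup (carrier P))
      {point_symmetry P x \<otimes>\<^bsub>BijGroup (carrier P)\<^esub> inv\<^bsub>BijGroup (carrier P)\<^esub> (point_symmetry P y) | x y.
        x \<in> carrier P \<and> y \<in> carrier P \<and> f x = f y}"

definition quandle_fiber :: "('a, 'm) quandle_struct_scheme \<Rightarrow> ('a \<Rightarrow> 'b) \<Rightarrow> 'b \<Rightarrow> 'a set"
  where "quandle_fiber P f q = {x \<in> carrier P. f x = q}"

locale strongly_connected_quandle_hom = quandle_hom +
  assumes surj: "f ` carrier P = carrier Q"
    and transitive_on_fibers: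
      "q \<in> carrier Q \<Longrightarrow>
        transitive_action (trans_rel P f) (quandle_fiber P f q)
          (\<lambda>g. restrict g (quandle_fiber P f q))"

definition quandle_prod ::
    "('a, 'm) quandle_struct_scheme \<Rightarrow> ('b, 'n) quandle_struct_scheme \<Rightarrow> ('a \<times> 'b) quandle_struct"
  where "quandle_prod P P' =
    \<lparr>carrier = carrier P \<times> carrier P',
     qsym = (\<lambda>(x, x'). map_prod (qsym P x) (qsym P' x'))\<rparr>"

end

theory Submission
  imports Defs
begin

text \<open>For fixed \<open>z \<in> P'\<close> the permutation \<open>s\<^sub>x s\<^sub>y\<^sup>-\<^sup>1 \<times> id\<close> equals
  \<open>s\<^sub>(\<^sub>x\<^sub>,\<^sub>z\<^sub>) s\<^sub>(\<^sub>y\<^sub>,\<^sub>z\<^sub>)\<^sup>-\<^sup>1\<close>. So \<open>g \<mapsto> g \<times> id\<close> maps the relative transvection group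
  of \<open>f\<close> into that of \<open>f \<times> f'\<close>, and likewise for \<open>f'\<close>; the products \<open>g \<times> g'\<close> then already
  act transitively on the fibers of \<open>f \<times> f'\<close>, which are products of fibers.\<close>

section \<open>Permutation groups and the relative transvection group\<close>

lemma carrier_BijGroup: "carrier (BijGroup S) = Bij S"
  by (simp add: BijGroup_def)

lemma mult_BijGroup:
  "\<lbrakk>g \<in> Bij S; h \<in> Bij S\<rbrakk> \<Longrightarrow> g \<otimes>\<^bsub>BijGroup S\<^esub> h = compose S g h"
  by (simp add: BijGroup_def)

lemma one_BijGroup: "\<one>\<^bsub>BijGroup S\<^esub> = (\<lambda>x\<in>S. x)"
  by (simp add: BijGroup_def)

lemma (in quandle) point_symmetry_Bij:
  "x \<in> carrier Q \<Longrightarrow> point_symmetry Q x \<in> Bij (carrier Q)"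
  using qsym_bij by (auto simp: point_symmetry_def Bij_def cong: bij_betw_cong)

text \<open>Serves as induction over generators: a property of all elements of
  \<open>trans_rel\<close> follows once the permutations having it form a subgroup \<open>H\<close>
  containing every s_x s_y^{-1} with f x = f y.\<close>

lemma (in quandle) trans_rel_minimal:
  assumes "subgroup H (BijGroup (carrier Q))"
    and "\<And>x y. \<lbrakk>x \<in> carrier Q; y \<in> carrier Q; f x = f y\<rbrakk> \<Longrightarrow>
      point_symmetry Q x \<otimes>\<^bsub>BijGroup (carrier Q)\<^esub> inv\<^bsub>BijGroup (carrier Q)\<^esub> point_symmetry Q y \<in> H"
  shows "carrier (trans_rel Q f) \<subseteq> H"
  unfolding trans_rel_def
  by (rule group.subgroup_generated_minimal[OF group_BijGroup assms(1)]) (use assms(2) in blast)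

lemma subgroup_trans_rel: "subgroup (carrier (trans_rel P f)) (BijGroup (carrier P))"
  unfolding trans_rel_def
  by (rule group.subgroup_subgroup_generated[OF group_BijGroup])

lemma trans_rel_mult: "mult (trans_rel P f) = mult (BijGroup (carrier P))"
  by (simp add: trans_rel_def subgroup_generated_def)

lemma trans_rel_Bij: "g \<in> carrier (trans_rel P f) \<Longrightarrow> g \<in> Bij (carrier P)"
  using subgroup.mem_carrier[OF subgroup_trans_rel] by (auto simp: carrier_BijGroup)

lemma (in quandle) transvection_in_trans_rel:
  assumes "x \<in> carrier Q" "y \<in> carrier Q" "f x = f y"
  shows "point_symmetry Q x \<otimes>\<^bsub>BijGroup (carrier Q)\<^esub> inv\<^bsub>BijGroup (carrier Q)\<^esub> point_symmetry Q y
    \<in> carrier (trans_rel Q f)"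
proof -
  interpret G: group "BijGroup (carrier Q)"
    by (rule group_BijGroup)
  \<comment> \<open>\<open>subgroup_generated\<close> intersects the generating set with the carrier
    of the ambient group, so s_x s_y^{-1} must be known to be a permutation before
    \<open>generate.incl\<close> applies.\<close>
  have "point_symmetry Q x \<in> carrier (BijGroup (carrier Q))"
    "point_symmetry Q y \<in> carrier (BijGroup (carrier Q))"
    using assms point_symmetry_Bij by (auto simp: carrier_BijGroup)
  then show ?thesis
    unfolding trans_rel_def carrier_subgroup_generated
    using assms by (intro generate.incl) auto
qed

section \<open>Action of the relative transvection group on fibers\<close>

lemma (in quandle_hom) trans_rel_preserves_fibers:
  assumes g: "g \<in> carrier (trans_rel P f)" and "z \<in> carrier P"
  shows "f (g z) = f z"
proof -
  let ?S = "carrier P"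
  let ?G = "BijGroup ?S"
  let ?H = "{g \<in> Bij ?S. \<forall>z\<in>?S. f (g z) = f z}"
  interpret G: group ?G
    by (rule group_BijGroup)
  have inv_eq: "(inv\<^bsub>?G\<^esub> a) z \<in> ?S \<and> a ((inv\<^bsub>?G\<^esub> a) z) = z" if "a \<in> Bij ?S" "z \<in> ?S" for a z
    using that Bij_inv_into_mem[OF that]
    by (auto simp: inv_BijGroup Bij_def bij_betw_def f_inv_into_f)
  have "subgroup ?H ?G"
  proof (rule G.subgroupI)
    show "?H \<subseteq> carrier ?G"
      by (auto simp: carrier_BijGroup)
    show "?H \<noteq> {}"
      using id_Bij[of ?S] by force
    show "inv\<^bsub>?G\<^esub> a \<in> ?H" if "a \<in> ?H" for a
      using that inv_eq[of a] G.inv_closed[of a] by (force simp: carrier_BijGroup)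
    show "a \<otimes>\<^bsub>?G\<^esub> b \<in> ?H" if "a \<in> ?H" "b \<in> ?H" for a b
      using that Bij_imp_funcset[of b ?S]
      by (auto simp: mult_BijGroup compose_Bij compose_eq Pi_iff)
  qed
  then have "carrier (trans_rel P f) \<subseteq> ?H"
  proof (rule P.trans_rel_minimal)
    fix x y assume xy: "x \<in> ?S" "y \<in> ?S" "f x = f y"
    let ?a = "point_symmetry P x" and ?b = "point_symmetry P y"
    have Bij: "?a \<in> Bij ?S" "?b \<in> Bij ?S"
      using xy P.point_symmetry_Bij by auto
    then have invb: "inv\<^bsub>?G\<^esub> ?b \<in> Bij ?S"
      using G.inv_closed by (simp add: carrier_BijGroup)
    have "f (compose ?S ?a (inv\<^bsub>?G\<^esub> ?b) z) = f z" if z: "z \<in> ?S" for z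
    proof -
      define w where "w = (inv\<^bsub>?G\<^esub> ?b) z"
      have w: "w \<in> ?S" "qsym P y w = z"
        using inv_eq[OF Bij(2) z] by (auto simp: w_def point_symmetry_def)
      \<comment> \<open>With w = s_y^{-1}(z) and f x = f y: f(s_x(w)) = s_{f x}(f w) = s_{f y}(f w)
        = f(s_y(w)) = f z. So each generator preserves fibers.\<close>
      have "f (qsym P x w) = f z"
        using xy w hom_qsym[of x w] hom_qsym[of y w] by simp
      then show ?thesis
        using w z by (simp add: compose_eq point_symmetry_def[of P x] flip: w_def)
    qed
    then show "?a \<otimes>\<^bsub>?G\<^esub> inv\<^bsub>?G\<^esub> ?b \<in> ?H"
      using Bij invb by (simp add: mult_BijGroup compose_Bij)
  qed
  then show ?thesis
    using assms by blast
qed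

text \<open>\<open>transitive_action\<close> includes being a group action; this supplies that part
  for the product map.\<close>

lemma (in quandle_hom) trans_rel_action:
  "group_action (trans_rel P f) (quandle_fiber P f q) (\<lambda>g. restrict g (quandle_fiber P f q))"
proof -
  let ?F = "quandle_fiber P f q"
  have FP: "?F \<subseteq> carrier P"
    by (auto simp: quandle_fiber_def)
  have maps: "g z \<in> ?F" if "g \<in> carrier (trans_rel P f)" "z \<in> ?F" for g z
    using that trans_rel_preserves_fibers[OF that(1)] Bij_imp_funcset[OF trans_rel_Bij[OF that(1)]]
    by (auto simp: quandle_fiber_def)
  have bij: "restrict g ?F \<in> Bij ?F" if g: "g \<in> carrier (trans_rel P f)" for g
  proof -
    have gP: "bij_betw g (carrier P) (carrier P)"
      using trans_rel_Bij[OF g] by (simp add: Bij_def)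
    \<comment> \<open>A preimage under \<open>g\<close> exists in the whole carrier; since
      \<open>g\<close> preserves the values of \<open>f\<close>, it lies in the same fiber.\<close>
    have "?F \<subseteq> g ` ?F"
    proof
      fix y assume y: "y \<in> ?F"
      then obtain x where "x \<in> carrier P" "y = g x"
        using gP FP by (auto simp: bij_betw_def)
      then show "y \<in> g ` ?F"
        using y trans_rel_preserves_fibers[OF g, of x] by (auto simp: quandle_fiber_def)
    qed
    then have "bij_betw g ?F ?F"
      using maps[OF g] gP FP by (auto simp: bij_betw_def intro: inj_on_subset)
    then show ?thesis
      by (auto simp: Bij_def cong: bij_betw_cong)
  qed
  \<comment> \<open>Restriction commutes with composition because \<open>h\<close> maps the fiber
    into itself.\<close>
  have "restrict (g \<otimes>\<^bsub>trans_rel P f\<^esub> h) ?F = restrict g ?F \<otimes>\<^bsub>BijGroup ?F\<^esub> restrict h ?F"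
    if "g \<in> carrier (trans_rel P f)" "h \<in> carrier (trans_rel P f)" for g h
    using that bij maps FP
    by (auto simp: trans_rel_mult mult_BijGroup trans_rel_Bij compose_def fun_eq_iff)
  moreover have "group (trans_rel P f)"
    unfolding trans_rel_def by (rule group.group_subgroup_generated[OF group_BijGroup])
  ultimately show ?thesis
    using bij
    by (auto simp: group_action_def group_hom_def group_hom_axioms_def group_BijGroup hom_def
        carrier_BijGroup)
qed

section \<open>Products of permutations\<close>

definition perm_prod :: "'a set \<Rightarrow> 'b set \<Rightarrow> ('a \<Rightarrow> 'a) \<Rightarrow> ('b \<Rightarrow> 'b) \<Rightarrow> 'a \<times> 'b \<Rightarrow> 'a \<times> 'b"
  where "perm_prod S T g h = restrict (map_prod g h) (S \<times> T)"

text \<open>Composition is componentwise, and the restriction in \<open>perm_prod\<close> gives the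
  extensionality that \<open>Bij\<close> demands. Phrasing this as a homomorphism from the direct
  product group yields compatibility with inverses for free in \<open>perm_prod_inv\<close>.\<close>

lemma perm_prod_hom:
  "(\<lambda>(g, h). perm_prod S T g h) \<in> hom (BijGroup S \<times>\<times> BijGroup T) (BijGroup (S \<times> T))"
proof -
  have bij: "perm_prod S T g h \<in> Bij (S \<times> T)" if "g \<in> Bij S" "h \<in> Bij T" for g h
    using that bij_betw_map_prod[of g S S h T T]
    by (auto simp: Bij_def perm_prod_def cong: bij_betw_cong)
  show ?thesis
  proof (rule homI)
    fix p r assume "p \<in> carrier (BijGroup S \<times>\<times> BijGroup T)" "r \<in> carrier (BijGroup S \<times>\<times> BijGroup T)"
    then obtain g h g' h' where [simp]: "p = (g, h)" "r = (g', h')"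
      and mem: "g \<in> Bij S" "h \<in> Bij T" "g' \<in> Bij S" "h' \<in> Bij T"
      by (auto simp: carrier_BijGroup)
    show "(\<lambda>(g, h). perm_prod S T g h) (p \<otimes>\<^bsub>BijGroup S \<times>\<times> BijGroup T\<^esub> r)
      = (\<lambda>(g, h). perm_prod S T g h) p \<otimes>\<^bsub>BijGroup (S \<times> T)\<^esub> (\<lambda>(g, h). perm_prod S T g h) r"
      using mem bij Bij_imp_funcset[OF mem(3)] Bij_imp_funcset[OF mem(4)]
      by (auto simp: mult_BijGroup perm_prod_def compose_def fun_eq_iff Pi_iff)
  qed (use bij in \<open>auto simp: carrier_BijGroup\<close>)
qed

lemma perm_prod_mult:
  assumes "g \<in> Bij S" "h \<in> Bij T" "g' \<in> Bij S" "h' \<in> Bij T"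
  shows "perm_prod S T (g \<otimes>\<^bsub>BijGroup S\<^esub> g') (h \<otimes>\<^bsub>BijGroup T\<^esub> h')
    = perm_prod S T g h \<otimes>\<^bsub>BijGroup (S \<times> T)\<^esub> perm_prod S T g' h'"
  using hom_mult[OF perm_prod_hom, of "(g, h)" S T "(g', h')"] assms by (simp add: carrier_BijGroup)

lemma perm_prod_inv:
  assumes "g \<in> Bij S" "h \<in> Bij T"
  shows "perm_prod S T (inv\<^bsub>BijGroup S\<^esub> g) (inv\<^bsub>BijGroup T\<^esub> h)
    = inv\<^bsub>BijGroup (S \<times> T)\<^esub> perm_prod S T g h"
proof -
  have "group_hom (BijGroup S \<times>\<times> BijGroup T) (BijGroup (S \<times> T)) (\<lambda>(g, h). perm_prod S T g h)"
    by (simp add: group_hom_def group_hom_axioms_def group_BijGroup DirProd_group perm_prod_hom)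
  from group_hom.hom_inv[OF this, of "(g, h)"] show ?thesis
    using assms by (simp add: carrier_BijGroup group_BijGroup inv_DirProd)
qed

section \<open>Product quandles and their transvections\<close>

lemma quandle_quandle_prod:
  assumes "quandle P" "quandle P'"
  shows "quandle (quandle_prod P P')"
proof -
  interpret P: quandle P by fact
  interpret P': quandle P' by fact
  show ?thesis
    by unfold_locales
      (auto simp: quandle_prod_def P.qsym_fixes P'.qsym_fixes P.qsym_distrib P'.qsym_distrib
        intro!: bij_betw_map_prod P.qsym_bij P'.qsym_bij)
qed

lemma quandle_hom_map_prod:
  assumes "quandle_hom P Q f" "quandle_hom P' Q' f'"
  shows "quandle_hom (quandle_prod P P') (quandle_prod Q Q') (map_prod f f')"
proof -
  interpret f: quandle_hom P Q f by fact
  interpret f': quandle_hom P' Q' f' by fact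
  interpret P: quandle "quandle_prod P P'"
    by (intro quandle_quandle_prod f.P.quandle_axioms f'.P.quandle_axioms)
  interpret Q: quandle "quandle_prod Q Q'"
    by (intro quandle_quandle_prod f.Q.quandle_axioms f'.Q.quandle_axioms)
  show ?thesis
    by unfold_locales
      (use f.hom_closed f'.hom_closed in
        \<open>auto simp: quandle_prod_def f.hom_qsym f'.hom_qsym\<close>)
qed

lemma carrier_quandle_prod: "carrier (quandle_prod P P') = carrier P \<times> carrier P'"
  by (simp add: quandle_prod_def)

lemma point_symmetry_quandle_prod:
  "point_symmetry (quandle_prod P P') (x, x')
    = perm_prod (carrier P) (carrier P') (point_symmetry P x) (point_symmetry P' x')"
  by (auto simp: point_symmetry_def perm_prod_def quandle_prod_def fun_eq_iff)

text \<open>The permutation equals s_{(x,x')} s_{(y,y')}^{-1}, and (x,x') and (y,y') have the same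
  image under \<open>map_prod f f'\<close>, so it is a generator of the group for the
  product.\<close>

lemma transvection_quandle_prod:
  assumes "quandle P" "quandle P'"
    and "x \<in> carrier P" "y \<in> carrier P" "x' \<in> carrier P'" "y' \<in> carrier P'"
    and "f x = f y" "f' x' = f' y'"
  shows "perm_prod (carrier P) (carrier P')
      (point_symmetry P x \<otimes>\<^bsub>BijGroup (carrier P)\<^esub> inv\<^bsub>BijGroup (carrier P)\<^esub> point_symmetry P y)
      (point_symmetry P' x' \<otimes>\<^bsub>BijGroup (carrier P')\<^esub> inv\<^bsub>BijGroup (carrier P')\<^esub> point_symmetry P' y')
    \<in> carrier (trans_rel (quandle_prod P P') (map_prod f f'))"
proof -
  note Bij = quandle.point_symmetry_Bij[OF assms(1)] quandle.point_symmetry_Bij[OF assms(2)]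
  have inv_Bij: "inv\<^bsub>BijGroup S\<^esub> g \<in> Bij S" if "g \<in> Bij S" for S and g :: "'z \<Rightarrow> 'z"
    using that group.inv_closed[OF group_BijGroup] by (metis carrier_BijGroup)
  show ?thesis
    using quandle.transvection_in_trans_rel[OF quandle_quandle_prod[OF assms(1,2)],
        of "(x, x')" "(y, y')" "map_prod f f'"] assms(3-)
    by (simp add: carrier_quandle_prod point_symmetry_quandle_prod perm_prod_mult perm_prod_inv
        Bij inv_Bij)
qed

text \<open>A generator in one factor has to be paired with a transvection in the other. The points
  given by nonemptiness allow the identity to be used there, written as s_z s_z^{-1}.\<close>

lemma perm_prod_trans_rel:
  assumes quandles: "quandle P" "quandle P'" and nonempty: "carrier P \<noteq> {}" "carrier P' \<noteq> {}"
    and g: "g \<in> carrier (trans_rel P f)" and g': "g' \<in> carrier (trans_rel P' f')"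
  shows "perm_prod (carrier P) (carrier P') g g'
    \<in> carrier (trans_rel (quandle_prod P P') (map_prod f f'))"
proof -
  let ?S = "carrier P" and ?S' = "carrier P'"
  let ?G = "BijGroup ?S" and ?G' = "BijGroup ?S'"
  let ?T = "carrier (trans_rel (quandle_prod P P') (map_prod f f'))"
  interpret G: group ?G by (rule group_BijGroup)
  interpret G': group ?G' by (rule group_BijGroup)
  interpret T: subgroup ?T "BijGroup (?S \<times> ?S')"
    using subgroup_trans_rel[of "quandle_prod P P'"] by (simp add: carrier_quandle_prod)
  note closed = G.inv_closed G.m_closed G.one_closed G'.inv_closed G'.m_closed G'.one_closed
  note Bij_closed = closed[unfolded carrier_BijGroup]
  have one: "perm_prod ?S ?S' \<one>\<^bsub>?G\<^esub> \<one>\<^bsub>?G'\<^esub> \<in> ?T"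
  proof -
    have "perm_prod ?S ?S' \<one>\<^bsub>?G\<^esub> \<one>\<^bsub>?G'\<^esub> = \<one>\<^bsub>BijGroup (?S \<times> ?S')\<^esub>"
      by (auto simp: perm_prod_def one_BijGroup)
    then show ?thesis
      using T.one_closed by simp
  qed
  obtain z z' where z: "z \<in> ?S" "z' \<in> ?S'"
    using nonempty by blast
  have cancel: "point_symmetry P z \<otimes>\<^bsub>?G\<^esub> inv\<^bsub>?G\<^esub> point_symmetry P z = \<one>\<^bsub>?G\<^esub>"
    "point_symmetry P' z' \<otimes>\<^bsub>?G'\<^esub> inv\<^bsub>?G'\<^esub> point_symmetry P' z' = \<one>\<^bsub>?G'\<^esub>"
    using quandles[THEN quandle.point_symmetry_Bij] z
    by (simp_all add: carrier_BijGroup)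
  \<comment> \<open>This is the preimage of the subgroup \<open>?T\<close> under g \<mapsto> g
    \<times> id. It contains the generators for \<open>f\<close> by
    \<open>transvection_quandle_prod\<close> with both second components equal to z'.\<close>
  have "subgroup {g \<in> Bij ?S. perm_prod ?S ?S' g \<one>\<^bsub>?G'\<^esub> \<in> ?T} ?G"
    using one perm_prod_mult[of _ ?S "\<one>\<^bsub>?G'\<^esub>" ?S' _ "\<one>\<^bsub>?G'\<^esub>"]
      perm_prod_inv[of _ ?S "\<one>\<^bsub>?G'\<^esub>" ?S']
    by (intro G.subgroupI) (auto simp: carrier_BijGroup Bij_closed intro!: exI[of _ "\<one>\<^bsub>?G\<^esub>"])
  then have "carrier (trans_rel P f) \<subseteq> {g \<in> Bij ?S. perm_prod ?S ?S' g \<one>\<^bsub>?G'\<^esub> \<in> ?T}"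
    using transvection_quandle_prod[OF quandles _ _ z(2) z(2), of _ _ f f'] cancel(2)
    by (intro quandle.trans_rel_minimal[OF quandles(1)])
      (auto simp: Bij_closed quandle.point_symmetry_Bij[OF quandles(1)])
  then have left: "perm_prod ?S ?S' g \<one>\<^bsub>?G'\<^esub> \<in> ?T"
    using g by blast
  have "subgroup {g' \<in> Bij ?S'. perm_prod ?S ?S' \<one>\<^bsub>?G\<^esub> g' \<in> ?T} ?G'"
    using one perm_prod_mult[of "\<one>\<^bsub>?G\<^esub>" ?S _ ?S' "\<one>\<^bsub>?G\<^esub>"]
      perm_prod_inv[of "\<one>\<^bsub>?G\<^esub>" ?S _ ?S']
    by (intro G'.subgroupI) (auto simp: carrier_BijGroup Bij_closed intro!: exI[of _ "\<one>\<^bsub>?G'\<^esub>"])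
  then have "carrier (trans_rel P' f') \<subseteq> {g' \<in> Bij ?S'. perm_prod ?S ?S' \<one>\<^bsub>?G\<^esub> g' \<in> ?T}"
    using transvection_quandle_prod[OF quandles z(1) z(1), of _ _ f f'] cancel(1)
    by (intro quandle.trans_rel_minimal[OF quandles(2)])
      (auto simp: Bij_closed quandle.point_symmetry_Bij[OF quandles(2)])
  then have right: "perm_prod ?S ?S' \<one>\<^bsub>?G\<^esub> g' \<in> ?T"
    using g' by blast
  \<comment> \<open>The two embeddings combine through g \<times> g' = (g \<times> id)(id \<times>
    g').\<close>
  have "perm_prod ?S ?S' g g'
    = perm_prod ?S ?S' g \<one>\<^bsub>?G'\<^esub> \<otimes>\<^bsub>BijGroup (?S \<times> ?S')\<^esub> perm_prod ?S ?S' \<one>\<^bsub>?G\<^esub> g'"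
    using trans_rel_Bij[OF g] trans_rel_Bij[OF g']
    by (simp add: Bij_closed carrier_BijGroup flip: perm_prod_mult)
  then show ?thesis
    using left right by simp
qed

section \<open>Transitivity on the fibers of the product map\<close>

theorem proposition3p33:
  fixes P :: "('a, 'm) quandle_struct_scheme" and Q :: "('b, 'n) quandle_struct_scheme"
    and P' :: "('c, 'k) quandle_struct_scheme" and Q' :: "('d, 'l) quandle_struct_scheme"
    and f :: "'a \<Rightarrow> 'b" and f' :: "'c \<Rightarrow> 'd"
  assumes "strongly_connected_quandle_hom P Q f"
    and "strongly_connected_quandle_hom P' Q' f'"
  shows "strongly_connected_quandle_hom (quandle_prod P P') (quandle_prod Q Q') (map_prod f f')"
proof -
  interpret f: strongly_connected_quandle_hom P Q f by fact
  interpret f': strongly_connected_quandle_hom P' Q' f' by fact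
  let ?R = "quandle_prod P P'" and ?k = "map_prod f f'"
  interpret k: quandle_hom ?R "quandle_prod Q Q'" ?k
    by (intro quandle_hom_map_prod f.quandle_hom_axioms f'.quandle_hom_axioms)
  show ?thesis
  proof (intro strongly_connected_quandle_hom.intro strongly_connected_quandle_hom_axioms.intro
      k.quandle_hom_axioms)
    show "?k ` carrier ?R = carrier (quandle_prod Q Q')"
      using f.surj f'.surj by (simp add: carrier_quandle_prod map_prod_surj_on)
  next
    fix r assume "r \<in> carrier (quandle_prod Q Q')"
    then obtain q q' where r: "r = (q, q')" and q: "q \<in> carrier Q" "q' \<in> carrier Q'"
      by (auto simp: carrier_quandle_prod)
    let ?F = "quandle_fiber ?R ?k r"
    have F: "?F = quandle_fiber P f q \<times> quandle_fiber P' f' q'"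
      by (auto simp: r quandle_fiber_def carrier_quandle_prod)
    \<comment> \<open>With the action in context, only the existence of a group element taking
      \<open>u\<close> to \<open>v\<close> remains to be shown.\<close>
    interpret A: group_action "trans_rel ?R ?k" ?F "\<lambda>g. restrict g ?F"
      by (rule k.trans_rel_action)
    show "transitive_action (trans_rel ?R ?k) ?F (\<lambda>g. restrict g ?F)"
    proof
      fix u v assume uv: "u \<in> ?F" "v \<in> ?F"
      obtain x x' y y' where [simp]: "u = (x, x')" "v = (y, y')"
        by (cases u, cases v)
      have mem: "x \<in> quandle_fiber P f q" "y \<in> quandle_fiber P f q"
        "x' \<in> quandle_fiber P' f' q'" "y' \<in> quandle_fiber P' f' q'"
        using uv by (auto simp: F)
      obtain g where g: "g \<in> carrier (trans_rel P f)" "g x = y"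
        using transitive_action.unique_orbit[OF f.transitive_on_fibers[OF q(1)] mem(1,2)] mem
        by auto
      obtain g' where g': "g' \<in> carrier (trans_rel P' f')" "g' x' = y'"
        using transitive_action.unique_orbit[OF f'.transitive_on_fibers[OF q(2)] mem(3,4)] mem
        by auto
      \<comment> \<open>The components of \<open>u\<close> witness the nonemptiness that
        \<open>perm_prod_trans_rel\<close> asks for.\<close>
      have carr: "x \<in> carrier P" "x' \<in> carrier P'"
        using mem by (auto simp: quandle_fiber_def)
      have "perm_prod (carrier P) (carrier P') g g' \<in> carrier (trans_rel ?R ?k)"
        using carr g(1) g'(1)
        by (intro perm_prod_trans_rel f.P.quandle_axioms f'.P.quandle_axioms) auto
      moreover have "restrict (perm_prod (carrier P) (carrier P') g g') ?F u = v"
        using uv carr g(2) g'(2) by (simp add: perm_prod_def)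
      ultimately show "\<exists>h\<in>carrier (trans_rel ?R ?k). restrict h ?F u = v"
        by blast
    qed
  qed
qed

end
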